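(* Let $\alpha>0$ and let $t_n$ be a sequence of natural numbers with $\lim_{n\to\infty}t_n=\lim_{n\to\infty}n^2/t_n=\infty$. Then $$\limsup_{n\to\infty}\max_{j\in[n]}\mathbb{P}^n_{id}\left(\left.\max_{0\le m\le t_n}|\Pi_m(j)-j|>\alpha\sqrt{\tfrac{t_n}{2}}\,\right|\,j\in A^{t_n}\right)\le 4\Psi(\alpha),$$ where $\Psi$ is the tail probability function of a standard normal random variable, $\Psi(x)=\mathbb{P}(N(0,1)\ge x)$.
   Context: The random-to-random insertions shuffle on a deck of $n$ cards numbered $1,\dots,n$: at each step a card is chosen uniformly at random, removed, and reinserted at a uniformly random position. Orderings are identified with $\sigma\in S_n$, $\sigma(j)$ being the position of card $j$; $\Pi_t$ is the induced random walk on $S_n$ and $\mathbb{P}^n_{id}$ its law started at the identity. $A^t$ denotes the (random) set of cards that have not been chosen for removal in the first $t$ shuffles. $[n]=\{1,\dots,n\}$. *)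

theory Defs
  imports "HOL-Probability.Probability"
begin

text \<open>An ordering of the deck is a function sigma with sigma j = position of card j
  (cards and positions are 1..n). One shuffle step is a pair (c, p): card c is removed
  and reinserted so that it ends up at position p.\<close>

definition rtr_step :: "(nat \<Rightarrow> nat) \<Rightarrow> nat \<times> nat \<Rightarrow> (nat \<Rightarrow> nat)" where
  "rtr_step \<sigma> cp = (\<lambda>j. let c = fst cp; p = snd cp in
     if j = c then p
     else (let q' = (if \<sigma> j > \<sigma> c then \<sigma> j - 1 else \<sigma> j)
           in if q' \<ge> p then q' + 1 else q'))"

definition rtr_walk :: "(nat \<times> nat) list \<Rightarrow> (nat \<Rightarrow> nat)" where
  "rtr_walk xs = foldl rtr_step id xs"

text \<open>Sample space of the first t shuffles: t independent uniform choices of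
  (card, position) in [n] x [n]; the law P^n_id is uniform on this finite set.\<close>
definition rtr_paths :: "nat \<Rightarrow> nat \<Rightarrow> (nat \<times> nat) list set" where
  "rtr_paths n t = {xs. length xs = t \<and> set xs \<subseteq> {1..n} \<times> {1..n}}"

definition rtr_A :: "(nat \<times> nat) list \<Rightarrow> nat set" where
  "rtr_A xs = {j. j \<notin> fst ` set xs}"

definition rtr_cond_prob ::
  "nat \<Rightarrow> nat \<Rightarrow> ((nat \<times> nat) list \<Rightarrow> bool) \<Rightarrow> ((nat \<times> nat) list \<Rightarrow> bool) \<Rightarrow> real" where
  "rtr_cond_prob n t E B =
     real (card {xs \<in> rtr_paths n t. E xs \<and> B xs}) / real (card {xs \<in> rtr_paths n t. B xs})"

definition Psi :: "real \<Rightarrow> real" where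
  "Psi x = measure (density lborel (normal_density 0 1)) {x..}"

end

theory Submission
  imports Defs "HOL-Real_Asymp.Real_Asymp"
begin

text \<open>A card that is never removed moves as a birth-death chain with up-rate x(n-x)/(n(n-1)) and
  down-rate (x-1)(n-x+1)/(n(n-1)), so both rates are at most 1/4 + O(1/n) and differ by at most 1/n.
  Compare it with the symmetric walk with steps -1, 0, 1 of probabilities 1/4, 1/2, 1/4. After s steps
  that walk is a centred Bin(2s, 1/2), so by reflection its probability of hitting level k is an
  explicit binomial tail. This tail is convex in k for k >= 0, so lowering the rates only
  decreases it, and its increments are O(1/sqrt s), so the drift costs at most
  O(sqrt t / n) = o(1) in t steps. One factor 2 comes from reflection, another from the two sides,
  and the central limit theorem for the binomial tail gives 4 Psi(alpha).\<close>

section \<open>Upper tails of the fair binomial distribution\<close>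

text \<open>The threshold is an integer, so that the recursion and the reflection below hold for
  every \<open>i\<close>, negative ones included.\<close>

definition btail :: "nat \<Rightarrow> int \<Rightarrow> real" where
  "btail N i = measure_pmf.prob (binomial_pmf N (1/2)) {l. i \<le> int l}"

lemma btail_0: "btail 0 i = (if i \<le> 0 then 1 else 0)"
  by (simp add: btail_def binomial_pmf_0 measure_return_pmf indicator_def)

lemma btail_Suc: "btail (Suc N) i = (btail N i + btail N (i - 1)) / 2"
proof -
  have shift: "{l. i \<le> 1 + int l} = {l. i - 1 \<le> int l}" by auto
  \<comment> \<open>\<open>emeasure\<close> of a bind unfolds to an integral over one fair coin, so
    the recursion is read off there and carried back to the reals.\<close>
  have "ennreal (btail (Suc N) i) = ennreal (btail N (i - 1)) * ennreal (1 / 2) + ennreal (btail N i) * ennreal (1 / 2)"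
    unfolding btail_def measure_pmf.emeasure_eq_measure[symmetric]
    by (simp add: binomial_pmf_Suc map_pmf_def[symmetric] shift)
  also have "\<dots> = ennreal (btail N (i - 1) * (1 / 2) + btail N i * (1 / 2))"
    by (subst (1 2) ennreal_mult[symmetric], simp_all only: btail_def measure_nonneg)
       (subst ennreal_plus[symmetric], simp_all)
  finally have "btail (Suc N) i = btail N (i - 1) * (1 / 2) + btail N i * (1 / 2)"
    by (subst (asm) ennreal_inj) (auto simp: btail_def)
  then show ?thesis by simp
qed

text \<open>A fair coin is symmetric: fewer than \<open>i\<close> heads means at least
  \<open>N + 1 - i\<close> tails. The recursion respects this symmetry.\<close>

lemma btail_reflect: "btail N i + btail N (int N + 1 - i) = 1"
proof (induction N arbitrary: i)
  case (Suc N)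
  show ?case using Suc[of i] Suc[of "i - 1"]
    by (simp add: btail_Suc algebra_simps add_divide_distrib[symmetric])
qed (simp add: btail_0)

text \<open>The increment is the point mass at \<open>i\<close>; under the tail recursion it obeys
  Pascal's rule.\<close>

lemma btail_diff:
  "btail N i - btail N (i + 1) = (if i < 0 then 0 else real (N choose nat i) / 2 ^ N)"
proof (induction N arbitrary: i)
  case 0
  then show ?case by (auto simp: btail_0 nat_eq_iff binomial_eq_0_iff)
next
  case (Suc N)
  have "btail (Suc N) i - btail (Suc N) (i + 1)
      = ((btail N i - btail N (i + 1)) + (btail N (i - 1) - btail N (i - 1 + 1))) / 2"
    by (simp add: btail_Suc field_simps)
  also have "\<dots> = (if i < 0 then 0 else real (Suc N choose nat i) / 2 ^ Suc N)"
  proof -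
    consider "i < 0" | "i = 0" | m where "i = int (Suc m)"
      by (metis linorder_cases not0_implies_Suc zero_less_imp_eq_int nat_less_le of_nat_0_less_iff)
    then show ?thesis
      unfolding Suc by cases (auto simp: field_simps nat_add_distrib)
  qed
  finally show ?case .
qed

lemma sqrt_mult_sqrt_le: "sqrt (2 * real s + 1) * sqrt (2 * real s + 3) \<le> 2 * real s + 2"
  unfolding real_sqrt_mult[symmetric]
  by (rule real_le_lsqrt) (auto simp: power2_eq_square algebra_simps)

text \<open>Passing from \<open>s\<close> to \<open>Suc s\<close> multiplies the left side by
  \<open>(2s+1)/(2s+2)\<close>, which by AM-GM is at most the ratio of the two bounds.\<close>

lemma central_binomial_upper_bound:
  "real ((2 * s) choose s) / 4 ^ s \<le> 1 / sqrt (2 * real s + 1)"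
proof (induction s)
  case (Suc s)
  let ?c = "real ((2 * s) choose s)" and ?d = "real ((2 * Suc s) choose Suc s)"
  have "Suc s * ((2 * Suc s) choose Suc s) = 2 * (2 * s + 1) * ((2 * s) choose s)"
  proof -
    have "Suc s * ((2 * Suc s) choose Suc s) = (2 * s + 2) * (Suc (2 * s) choose s)"
      using Suc_times_binomial_eq[of "Suc (2 * s)" s] by (simp add: mult.commute)
    also have "Suc (2 * s) choose s = Suc (2 * s) choose Suc s"
      using binomial_symmetric[of s "Suc (2 * s)"] by simp
    also have "(2 * s + 2) * (Suc (2 * s) choose Suc s) = 2 * (Suc s * (Suc (2 * s) choose Suc s))"
      by simp
    also have "Suc s * (Suc (2 * s) choose Suc s) = Suc (2 * s) * ((2 * s) choose s)"
      using Suc_times_binomial_eq[of "2 * s" s] by (simp add: mult.commute)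
    finally show ?thesis by simp
  qed
  then have "real (Suc s) * ?d = 2 * (2 * real s + 1) * ?c"
    by (metis (no_types, lifting) of_nat_1 of_nat_add of_nat_mult of_nat_numeral)
  then have "?d = (2 * (2 * real s + 1) * ?c) / (real s + 1)"
    by (simp add: eq_divide_eq mult.commute add.commute)
  then have "?d / 4 ^ Suc s = (2 * real s + 1) / (2 * real s + 2) * (?c / 4 ^ s)"
    by (simp del: binomial_Suc_Suc) (simp add: divide_simps algebra_simps)
  also have "\<dots> \<le> (2 * real s + 1) / (2 * real s + 2) * (1 / sqrt (2 * real s + 1))"
    by (intro mult_left_mono Suc) auto
  also have "\<dots> = sqrt (2 * real s + 1) / (2 * real s + 2)"
    by (simp add: real_div_sqrt field_simps)
  also have "\<dots> \<le> 1 / sqrt (2 * real (Suc s) + 1)"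
    using sqrt_mult_sqrt_le[of s] by (simp add: field_simps add_ac)
  finally show ?case .
qed simp

section \<open>Hitting probabilities of the symmetric lazy walk\<close>

text \<open>The probability P(S_s >= k) + P(S_s > k), given by the reflection principle, that a walk S with steps
  -1, 0, 1 of probabilities 1/4, 1/2, 1/4 hits level k >= 0 within s steps; Pascal's rule
  merges the two Bin(2s, 1/2) tails into one Bin(2s+1, 1/2) tail.\<close>

definition hit :: "nat \<Rightarrow> int \<Rightarrow> real" where
  "hit s k = 2 * btail (2 * s + 1) (int s + 1 + k)"

lemma hit_nonneg: "0 \<le> hit s k"
  by (simp add: hit_def btail_def)

text \<open>Two more coins make one lazy step: this is the backward equation of the walk. It holds
  for all \<open>k\<close>, also for negative ones, where \<open>hit\<close> exceeds 1.\<close>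

lemma hit_Suc: "hit (Suc s) k = hit s k / 2 + (hit s (k - 1) + hit s (k + 1)) / 4"
proof -
  have "2 * Suc s + 1 = Suc (Suc (2 * s + 1))" by simp
  then show ?thesis
    by (simp only: hit_def btail_Suc) (simp add: algebra_simps add_divide_distrib)
qed

lemma hit_diff:
  "hit s k - hit s (k + 1) = (if int s + 1 + k < 0 then 0
     else real ((2 * s + 1) choose nat (int s + 1 + k)) / 4 ^ s)"
proof -
  have "(2::real) ^ (2 * s + 1) = 2 * 4 ^ s" by (simp add: power_mult)
  then show ?thesis
    using btail_diff[of "2 * s + 1" "int s + 1 + k"]
    by (simp add: hit_def add_ac split: if_splits)
qed

lemma hit_antimono: "k \<le> l \<Longrightarrow> hit s l \<le> hit s k"
proof (induction l rule: int_ge_induct)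
  case (step i)
  have "0 \<le> hit s i - hit s (i + 1)" by (simp add: hit_diff)
  with step show ?case by simp
qed simp

text \<open>By symmetry \<open>Bin(2s+1, 1/2)\<close> reaches \<open>s + 1\<close> with probability
  exactly 1/2. This is the boundary value for a level already reached.\<close>

lemma hit_ge_1:
  assumes "k \<le> 0"
  shows "1 \<le> hit s k"
proof -
  have "hit s 0 = 1"
    using btail_reflect[of "2 * s + 1" "int s + 1"] by (simp add: hit_def algebra_simps)
  with hit_antimono[OF assms, of s] show ?thesis by simp
qed

text \<open>The increments are entries of row \<open>2s+1\<close> of Pascal's triangle, which
  decrease to the right of the middle.\<close>

lemma hit_convex:
  assumes "k \<ge> 1"
  shows "hit s k - hit s (k + 1) \<le> hit s (k - 1) - hit s k"
proof -
  have "(2 * s + 1) choose (nat (int s + 1 + k)) \<le> (2 * s + 1) choose (nat (int s + k))"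
  proof (cases "nat (int s + 1 + k) \<le> 2 * s + 1")
    case True
    with assms show ?thesis by (intro binomial_antimono) auto
  next
    case False
    then show ?thesis by (subst binomial_eq_0) auto
  qed
  with assms show ?thesis
    using hit_diff[of s k] hit_diff[of s "k - 1"] by (simp add: divide_right_mono add_ac)
qed

text \<open>The largest entry of row \<open>2s+1\<close> is half the central entry of row
  \<open>2s+2\<close>. This bounds the cost of one unit of drift.\<close>

lemma hit_diff_le: "hit s k - hit s (k + 1) \<le> 2 / sqrt (2 * real s + 3)"
proof (cases "int s + 1 + k < 0")
  case True
  then show ?thesis by (simp add: hit_diff)
next
  case False
  let ?c = "(2 * s + 1) choose s"
  have "hit s k - hit s (k + 1) \<le> real ?c / 4 ^ s"
    using False binomial_maximum[of "2 * s + 1" "nat (int s + 1 + k)"]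
    by (simp add: hit_diff divide_right_mono)
  also have "\<dots> = 2 * (real ((2 * Suc s) choose Suc s) / 4 ^ Suc s)"
  proof -
    have "?c = Suc (2 * s) choose Suc s"
      using binomial_symmetric[of s "Suc (2 * s)"] by simp
    then have "(2 * Suc s) choose Suc s = 2 * ?c"
      using binomial_Suc_Suc[of "Suc (2 * s)" s] by simp
    then show ?thesis by simp
  qed
  also have "\<dots> \<le> 2 * (1 / sqrt (2 * real (Suc s) + 1))"
    by (intro mult_left_mono central_binomial_upper_bound) simp
  finally show ?thesis by (simp add: add_ac)
qed

section \<open>Counting exiting paths with a supersolution\<close>

text \<open>The supermartingale argument in counting form, by induction on the first letter.
  \<open>V s\<close> is a bound with \<open>s\<close> steps to go, and \<open>I\<close> is an
  invariant of the reachable states.\<close>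

lemma exit_count_le:
  fixes f :: "'s \<Rightarrow> 'c \<Rightarrow> 's" and V :: "nat \<Rightarrow> 's \<Rightarrow> real"
  assumes "finite C"
    and I: "\<And>\<sigma> c. I \<sigma> \<Longrightarrow> c \<in> C \<Longrightarrow> I (f \<sigma> c)"
    and nonneg: "\<And>s \<sigma>. I \<sigma> \<Longrightarrow> 0 \<le> V s \<sigma>"
    and exit: "\<And>s \<sigma>. I \<sigma> \<Longrightarrow> P \<sigma> \<Longrightarrow> 1 \<le> V s \<sigma>"
    and super: "\<And>s \<sigma>. I \<sigma> \<Longrightarrow> \<not> P \<sigma> \<Longrightarrow> (\<Sum>c\<in>C. V s (f \<sigma> c)) \<le> real (card C) * V (Suc s) \<sigma>"
    and "I \<sigma>"
  shows "real (card {xs. length xs = s \<and> set xs \<subseteq> C \<and> (\<exists>m\<le>s. P (foldl f \<sigma> (take m xs)))})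
    \<le> real (card C) ^ s * V s \<sigma>"
  using \<open>I \<sigma>\<close>
proof (induction s arbitrary: \<sigma>)
  case (0 \<sigma>)
  have "{xs. length xs = 0 \<and> set xs \<subseteq> C \<and> (\<exists>m\<le>0. P (foldl f \<sigma> (take m xs)))} = (if P \<sigma> then {[]} else {})"
    by auto
  then have "card {xs. length xs = 0 \<and> set xs \<subseteq> C \<and> (\<exists>m\<le>0. P (foldl f \<sigma> (take m xs)))} = (if P \<sigma> then 1 else 0)"
    by (simp only: if_distrib[of card]) simp
  then show ?case using exit[OF 0, of 0] nonneg[OF 0, of 0] by (cases "P \<sigma>") simp_all
next
  case (Suc s \<sigma>)
  let ?E = "\<lambda>s \<sigma>. {xs. length xs = s \<and> set xs \<subseteq> C \<and> (\<exists>m\<le>s. P (foldl f \<sigma> (take m xs)))}"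
  show ?case
  proof (cases "P \<sigma>")
    case True
    have "card (?E (Suc s) \<sigma>) \<le> card {xs. set xs \<subseteq> C \<and> length xs = Suc s}"
      by (intro card_mono finite_lists_length_eq \<open>finite C\<close>) auto
    also have "\<dots> = card C ^ Suc s"
      by (rule card_lists_length_eq[OF \<open>finite C\<close>])
    finally have "real (card (?E (Suc s) \<sigma>)) \<le> real (card C) ^ Suc s * 1"
      by (simp only: mult_1_right of_nat_le_iff of_nat_power[symmetric])
    also have "\<dots> \<le> real (card C) ^ Suc s * V (Suc s) \<sigma>"
      by (intro mult_left_mono exit Suc.prems True) simp
    finally show ?thesis .
  next
    case False
    have fin: "finite (?E s \<tau>)" for \<tau>
      by (rule finite_subset[OF _ finite_lists_length_eq[OF \<open>finite C\<close>, of s]]) auto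
    have "?E (Suc s) \<sigma> \<subseteq> (\<Union>c\<in>C. (#) c ` ?E s (f \<sigma> c))"
    proof
      fix xs assume xs: "xs \<in> ?E (Suc s) \<sigma>"
      then obtain c ys where c: "xs = c # ys" by (cases xs) auto
      from xs obtain m where m: "m \<le> Suc s" "P (foldl f \<sigma> (take m xs))" by auto
      \<comment> \<open>The exit does not happen at time 0, so it survives dropping the first
        letter.\<close>
      with False obtain m' where "m = Suc m'" by (cases m) auto
      with m c have "m' \<le> s" "P (foldl f (f \<sigma> c) (take m' ys))" by simp_all
      with xs c have "ys \<in> ?E s (f \<sigma> c)" "c \<in> C" by auto
      with c show "xs \<in> (\<Union>c\<in>C. (#) c ` ?E s (f \<sigma> c))" by blast
    qed
    then have "card (?E (Suc s) \<sigma>) \<le> card (\<Union>c\<in>C. (#) c ` ?E s (f \<sigma> c))"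
      using fin \<open>finite C\<close> by (intro card_mono) auto
    also have "\<dots> \<le> (\<Sum>c\<in>C. card ((#) c ` ?E s (f \<sigma> c)))"
      by (rule card_UN_le[OF \<open>finite C\<close>])
    also have "\<dots> \<le> (\<Sum>c\<in>C. card (?E s (f \<sigma> c)))"
      by (intro sum_mono card_image_le fin)
    finally have "real (card (?E (Suc s) \<sigma>)) \<le> (\<Sum>c\<in>C. real (card (?E s (f \<sigma> c))))"
      by (simp only: of_nat_le_iff of_nat_sum[symmetric])
    also have "\<dots> \<le> (\<Sum>c\<in>C. real (card C) ^ s * V s (f \<sigma> c))"
      by (intro sum_mono Suc.IH I Suc.prems)
    also have "\<dots> = real (card C) ^ s * (\<Sum>c\<in>C. V s (f \<sigma> c))"
      by (simp add: sum_distrib_left)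
    also have "\<dots> \<le> real (card C) ^ s * (real (card C) * V (Suc s) \<sigma>)"
      by (intro mult_left_mono super Suc.prems False) simp
    finally show ?thesis by (simp add: mult_ac)
  qed
qed

section \<open>One shuffle seen from a card that is not removed\<close>

text \<open>A step closes the gap at \<open>\<sigma> c\<close> (the map \<open>q\<close>) and opens
  one at \<open>p\<close> (the map \<open>r\<close>). Off \<open>\<sigma> c\<close> the first is
  injective; the second is injective and misses \<open>p\<close>, the new place of
  \<open>c\<close>.\<close>

lemma bij_betw_rtr_step:
  assumes \<sigma>: "bij_betw \<sigma> {1..n} {1..n}" and cp: "c \<in> {1..n}" "p \<in> {1..n}"
  shows "bij_betw (rtr_step \<sigma> (c, p)) {1..n} {1..n}"
proof -
  have rng: "\<sigma> i \<in> {1..n}" if "i \<in> {1..n}" for i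
    using bij_betwE[OF \<sigma>] that by blast
  have ne: "\<sigma> i \<noteq> \<sigma> k" if "i \<in> {1..n}" "k \<in> {1..n}" "i \<noteq> k" for i k
    using bij_betw_imp_inj_on[OF \<sigma>] that by (simp add: inj_on_eq_iff)
  define q where "q u = (if u > \<sigma> c then u - 1 else u)" for u
  define r where "r v = (if v \<ge> p then v + 1 else v)" for v
  have step: "rtr_step \<sigma> (c, p) i = (if i = c then p else r (q (\<sigma> i)))" for i
    by (simp add: rtr_step_def q_def r_def)
  have q_inj: "u = v" if "q u = q v" "u \<noteq> \<sigma> c" "v \<noteq> \<sigma> c" for u v
    using that by (simp add: q_def split: if_splits)
  have r_inj: "u = v" if "r u = r v" for u v
    using that by (simp add: r_def split: if_splits)
  have r_ne: "r v \<noteq> p" for v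
    by (simp add: r_def)
  have "inj_on (rtr_step \<sigma> (c, p)) {1..n}"
    unfolding inj_on_def step using r_ne r_inj q_inj ne cp(1) by metis
  moreover have "rtr_step \<sigma> (c, p) i \<in> {1..n}" if "i \<in> {1..n}" for i
    using rng[OF that] rng[OF cp(1)] ne[OF that cp(1)] cp by (auto simp: rtr_step_def Let_def)
  ultimately show ?thesis
    by (metis bij_betw_def endo_inj_surj finite_atLeastAtMost image_subsetI)
qed

lemma sum_threshold:
  fixes A B :: real
  assumes "q \<le> n"
  shows "(\<Sum>p\<in>{1..n}. if p \<le> q then A else B) = real q * A + (real n - real q) * B"
proof -
  have "{1..n} \<inter> {p. p \<le> q} = {1..q}" "{1..n} \<inter> - {p. p \<le> q} = {q<..n}"
    using assms by auto
  then show ?thesis using assms by (simp add: sum.If_cases of_nat_diff)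
qed

text \<open>The generator of the position of \<open>j\<close>. Each of the \<open>n - x\<close>
  cards at higher positions pushes \<open>j\<close> up when reinserted at \<open>p \<le> x\<close>;
  each of the \<open>x - 1\<close> cards at lower positions lets \<open>j\<close> drop unless
  \<open>p \<le> x - 1\<close>. The values of \<open>\<phi>\<close> at 0 and \<open>n + 1\<close>
  only occur with coefficient 0.\<close>

lemma sum_rtr_step:
  fixes \<phi> :: "nat \<Rightarrow> real"
  assumes \<sigma>: "bij_betw \<sigma> {1..n} {1..n}" and j: "j \<in> {1..n}" and x: "x = \<sigma> j"
  shows "(\<Sum>cp\<in>({1..n} - {j}) \<times> {1..n}. \<phi> (rtr_step \<sigma> cp j))
    = real n * (real n - 1) * \<phi> x + real x * (real n - real x) * (\<phi> (x + 1) - \<phi> x)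
      + (real x - 1) * (real n - real x + 1) * (\<phi> (x - 1) - \<phi> x)"
proof -
  have x_in: "1 \<le> x" "x \<le> n" using \<sigma> j x by (auto simp: bij_betw_def)
  define H where "H y = (\<Sum>p\<in>{1..n}. \<phi> (let q' = (if x > y then x - 1 else x)
           in if q' \<ge> p then q' + 1 else q'))" for y
  have "(\<Sum>cp\<in>({1..n} - {j}) \<times> {1..n}. \<phi> (rtr_step \<sigma> cp j))
      = (\<Sum>c\<in>{1..n} - {j}. \<Sum>p\<in>{1..n}. \<phi> (rtr_step \<sigma> (c, p) j))"
    by (subst sum.cartesian_product) simp
  also have "\<dots> = (\<Sum>c\<in>{1..n} - {j}. H (\<sigma> c))"
    unfolding H_def
    by (intro sum.cong refl) (auto simp: rtr_step_def x Let_def)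
  \<comment> \<open>\<open>H\<close> sees the removed card only through its position, so bijectivity
    turns the sum over cards into one over positions.\<close>
  also have "\<dots> = (\<Sum>y\<in>{1..n} - {x}. H y)"
    by (rule sum.reindex_bij_betw, unfold x, rule bij_betw_DiffI[OF \<sigma>]) (use j x_in x in \<open>auto simp: bij_betw_def\<close>)
  also have "{1..n} - {x} = {1..<x} \<union> {x<..n}"
    using x_in by auto
  also have "(\<Sum>y\<in>{1..<x} \<union> {x<..n}. H y) = (\<Sum>y\<in>{1..<x}. H y) + (\<Sum>y\<in>{x<..n}. H y)"
    by (rule sum.union_disjoint) auto
  also have "(\<Sum>y\<in>{1..<x}. H y) = (\<Sum>y\<in>{1..<x}. (real x - 1) * \<phi> x + (real n - real x + 1) * \<phi> (x - 1))"
  proof (rule sum.cong)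
    fix y assume y: "y \<in> {1..<x}"
    have "H y = (\<Sum>p\<in>{1..n}. if p \<le> x - 1 then \<phi> x else \<phi> (x - 1))"
      unfolding H_def by (intro sum.cong) (use y in \<open>auto simp: Let_def\<close>)
    also have "\<dots> = real (x - 1) * \<phi> x + (real n - real (x - 1)) * \<phi> (x - 1)"
      using x_in by (intro sum_threshold) simp
    finally show "H y = (real x - 1) * \<phi> x + (real n - real x + 1) * \<phi> (x - 1)"
      using x_in by (simp add: of_nat_diff)
  qed simp
  also have "(\<Sum>y\<in>{x<..n}. H y) = (\<Sum>y\<in>{x<..n}. real x * \<phi> (x + 1) + (real n - real x) * \<phi> x)"
  proof (rule sum.cong)
    fix y assume y: "y \<in> {x<..n}"
    have "H y = (\<Sum>p\<in>{1..n}. if p \<le> x then \<phi> (x + 1) else \<phi> x)"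
      unfolding H_def by (intro sum.cong) (use y in \<open>auto simp: Let_def\<close>)
    also have "\<dots> = real x * \<phi> (x + 1) + (real n - real x) * \<phi> x"
      using x_in(2) by (rule sum_threshold)
    finally show "H y = real x * \<phi> (x + 1) + (real n - real x) * \<phi> x" .
  qed simp
  finally show ?thesis
    using x_in by (simp add: of_nat_diff algebra_simps)
qed

text \<open>Write \<open>U a - D b = D (a - b) + (U - D) a\<close>, and symmetrically with
  \<open>U\<close> and \<open>D\<close> exchanged. AM-GM bounds both rates by a quarter of
  \<open>n\<close> squared, and they differ by at most \<open>n - 1\<close>. The two conclusions
  serve the upper and the lower exit level.\<close>

lemma birth_death_le:
  fixes a b U D n x :: real
  assumes "n \<ge> 2" "1 \<le> x" "x \<le> n" "0 \<le> b" "b \<le> a"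
    and UD: "U = x * (n - x)" "D = (x - 1) * (n - x + 1)"
  shows "U * a - D * b \<le> n * (n - 1) * ((a - b) / 4 + 2 / n * a)"
    and "D * a - U * b \<le> n * (n - 1) * ((a - b) / 4 + 2 / n * a)"
proof -
  have quarter: "U \<le> n\<^sup>2 / 4" "D \<le> n\<^sup>2 / 4"
    using sum_squares_bound[of x "n - x"] sum_squares_bound[of "x - 1" "n - x + 1"] UD
    by (auto simp: power2_eq_square algebra_simps)
  have drift: "U - D \<le> n - 1" "D - U \<le> n - 1"
    using assms by (auto simp: algebra_simps)
  have "n\<^sup>2 / 4 * (a - b) + (n - 1) * a \<le> n * (n - 1) * ((a - b) / 4 + 2 / n * a)"
  proof -
    \<comment> \<open>Normalizing by \<open>n * (n - 1)\<close> costs an extra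
      \<open>n * (a - b) / 4\<close>; the constant 2 leaves \<open>(n - 1) * a\<close> to pay for
      it.\<close>
    have "n * (a - b) \<le> 4 * (n - 1) * a"
    proof -
      have "n * (a - b) \<le> n * a" using assms by (intro mult_left_mono) auto
      also have "\<dots> \<le> 4 * (n - 1) * a" using assms by (intro mult_right_mono) auto
      finally show ?thesis .
    qed
    moreover have "n * (n - 1) * ((a - b) / 4 + 2 / n * a) = (n\<^sup>2 - n) * (a - b) / 4 + 2 * (n - 1) * a"
      using assms by (simp add: field_simps power2_eq_square)
    ultimately show ?thesis
      by (simp only:) (simp add: algebra_simps add_divide_distrib diff_divide_distrib power2_eq_square)
  qed
  moreover have "U * a - D * b = D * (a - b) + (U - D) * a" "D * a - U * b = U * (a - b) + (D - U) * a"
    by (simp_all add: algebra_simps)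
  moreover have "D * (a - b) \<le> n\<^sup>2 / 4 * (a - b)" "U * (a - b) \<le> n\<^sup>2 / 4 * (a - b)"
      "(U - D) * a \<le> (n - 1) * a" "(D - U) * a \<le> (n - 1) * a"
    using quarter drift assms(4,5) by (auto intro!: mult_right_mono simp del: times_divide_eq_left)
  ultimately show "U * a - D * b \<le> n * (n - 1) * ((a - b) / 4 + 2 / n * a)"
    and "D * a - U * b \<le> n * (n - 1) * ((a - b) / 4 + 2 / n * a)"
    by linarith+
qed

section \<open>The barrier and the exit bound\<close>

text \<open>Lets the drift costs of the successive steps telescope into a single square
  root.\<close>

lemma sqrt_increment: "1 / sqrt (2 * real s + 3) \<le> sqrt (2 * real s + 3) - sqrt (2 * real s + 1)"
proof -
  have "1 \<le> (sqrt (2 * real s + 3) - sqrt (2 * real s + 1)) * sqrt (2 * real s + 3)"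
    using sqrt_mult_sqrt_le[of s] by (simp add: algebra_simps)
  then show ?thesis by (simp add: divide_le_eq)
qed

text \<open>The first two terms are the reflection-principle bound for leaving the interval
  of radius K around j; the last one absorbs the drift of the chain, which is at most 1/n per step.\<close>

definition barrier :: "nat \<Rightarrow> int \<Rightarrow> nat \<Rightarrow> nat \<Rightarrow> nat \<Rightarrow> real" where
  "barrier n K j s x = hit s (K - (int x - int j)) + hit s (K + (int x - int j))
     + 8 * sqrt (2 * real s + 1) / real n"

lemma barrier_nonneg: "0 \<le> barrier n K j s x"
  by (simp add: barrier_def hit_nonneg add_nonneg_nonneg)

lemma barrier_ge_1:
  assumes "\<bar>int x - int j\<bar> \<ge> K"
  shows "1 \<le> barrier n K j s x"
proof -
  have "1 \<le> hit s (K - (int x - int j)) + hit s (K + (int x - int j))"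
    using assms hit_ge_1[of "K - (int x - int j)" s] hit_ge_1[of "K + (int x - int j)" s]
      hit_nonneg[of s "K - (int x - int j)"] hit_nonneg[of s "K + (int x - int j)"]
    by (cases "int x \<ge> int j") auto
  then show ?thesis by (simp add: barrier_def add_increasing2)
qed

text \<open>\<open>k\<close> and \<open>l\<close> are the distances to the upper and lower exit
  levels, both at least 1 inside the interval, where convexity applies. Laziness and diffusion
  reproduce the backward equation of \<open>hit\<close>; the square root term pays for the
  drift.\<close>

lemma barrier_supersolution:
  assumes n: "n \<ge> 2" and \<sigma>: "bij_betw \<sigma> {1..n} {1..n}" and j: "j \<in> {1..n}"
    and inside: "\<bar>int (\<sigma> j) - int j\<bar> < K"
  shows "(\<Sum>cp\<in>({1..n} - {j}) \<times> {1..n}. barrier n K j s (rtr_step \<sigma> cp j))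
    \<le> real n * (real n - 1) * barrier n K j (Suc s) (\<sigma> j)"
proof -
  define x where "x = \<sigma> j"
  have x_in: "1 \<le> x" "x \<le> n" using \<sigma> j by (auto simp: bij_betw_def x_def)
  define U where "U = real x * (real n - real x)"
  define D where "D = (real x - 1) * (real n - real x + 1)"
  define N where "N = real n * (real n - 1)"
  define e where "e = 2 / sqrt (2 * real s + 3)"
  define k where "k = K - (int x - int j)"
  define l where "l = K + (int x - int j)"
  have kl: "k \<ge> 1" "l \<ge> 1" using inside by (auto simp: k_def l_def x_def)
  define a where "a = hit s (k - 1) - hit s k"
  define b where "b = hit s k - hit s (k + 1)"
  define a' where "a' = hit s (l - 1) - hit s l"
  define b' where "b' = hit s l - hit s (l + 1)"
  have ab: "0 \<le> b" "b \<le> a" "a \<le> e" "0 \<le> b'" "b' \<le> a'" "a' \<le> e"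
    using hit_antimono[of k "k + 1" s] hit_antimono[of l "l + 1" s] hit_convex[OF kl(1), of s]
      hit_convex[OF kl(2), of s] hit_diff_le[of s "k - 1"] hit_diff_le[of s "l - 1"]
    by (auto simp: a_def b_def a'_def b'_def e_def)
  have N: "0 \<le> N" using n by (simp add: N_def)
  have pos: "K - (int (x + 1) - int j) = k - 1" "K + (int (x + 1) - int j) = l + 1"
    "K - (int (x - 1) - int j) = k + 1" "K + (int (x - 1) - int j) = l - 1"
    using x_in by (auto simp: k_def l_def)
  have up: "barrier n K j s (x + 1) - barrier n K j s x = a - b'"
    and down: "barrier n K j s (x - 1) - barrier n K j s x = a' - b"
    by (simp_all only: barrier_def pos) (simp_all add: a_def b_def a'_def b'_def k_def l_def)
  have "(\<Sum>cp\<in>({1..n} - {j}) \<times> {1..n}. barrier n K j s (rtr_step \<sigma> cp j))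
      = N * barrier n K j s x + U * (a - b') + D * (a' - b)"
    unfolding sum_rtr_step[OF \<sigma> j x_def] up down by (simp add: U_def D_def N_def)
  \<comment> \<open>Regrouping by exit level instead of by direction of the move.\<close>
  also have "\<dots> = N * barrier n K j s x + (U * a - D * b) + (D * a' - U * b')"
    by (simp add: algebra_simps)
  also have "\<dots> \<le> N * barrier n K j s x + N * ((a - b) / 4 + 2 / real n * a)
      + N * ((a' - b') / 4 + 2 / real n * a')"
    unfolding N_def using n x_in ab
    by (intro add_mono order_refl birth_death_le) (auto simp: U_def D_def)
  also have "\<dots> = N * (barrier n K j s x + (a - b) / 4 + (a' - b') / 4 + 2 / real n * (a + a'))"
    by (simp add: algebra_simps add_divide_distrib)
  also have "\<dots> \<le> N * (barrier n K j s x + (a - b) / 4 + (a' - b') / 4 + 2 / real n * (2 * e))"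
    using ab N by (intro mult_left_mono add_left_mono) auto
  also have "\<dots> \<le> N * barrier n K j (Suc s) x"
  proof (rule mult_left_mono[OF _ N])
    \<comment> \<open>The coefficient 8 in \<open>barrier\<close> comes from here: two levels, each
      with drift cost \<open>2 / n * e\<close>, where \<open>e\<close> itself carries a factor
      2.\<close>
    have "2 / real n * (2 * e) = 8 / real n * (1 / sqrt (2 * real s + 3))"
      by (simp add: e_def)
    also have "\<dots> \<le> 8 / real n * (sqrt (2 * real s + 3) - sqrt (2 * real s + 1))"
      by (intro mult_left_mono sqrt_increment) simp
    finally have "2 / real n * (2 * e) \<le> 8 * sqrt (2 * real s + 3) / real n - 8 * sqrt (2 * real s + 1) / real n"
      by (simp add: algebra_simps diff_divide_distrib)
    moreover have "2 * real (Suc s) + 1 = 2 * real s + 3" by simp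
    moreover have "hit (Suc s) k = hit s k + (a - b) / 4" "hit (Suc s) l = hit s l + (a' - b') / 4"
      by (simp_all add: hit_Suc a_def b_def a'_def b'_def field_simps)
    ultimately show "barrier n K j s x + (a - b) / 4 + (a' - b') / 4 + 2 / real n * (2 * e)
        \<le> barrier n K j (Suc s) x"
      unfolding barrier_def k_def[symmetric] l_def[symmetric] by (simp add: add.commute)
  qed
  finally show ?thesis by (simp add: N_def x_def)
qed

text \<open>Given that \<open>j\<close> is never chosen, the path is uniform over the words of
  length \<open>t\<close> in the pairs whose card is not \<open>j\<close>, so counting exits
  suffices. At the start both levels are at distance \<open>K\<close>, hence the factor 2.\<close>

lemma rtr_cond_prob_exit_le:
  assumes n: "n \<ge> 2" and j: "j \<in> {1..n}" and a: "a \<ge> 0"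
  shows "rtr_cond_prob n t (\<lambda>xs. \<exists>m\<le>t. \<bar>real (rtr_walk (take m xs) j) - real j\<bar> > a) (\<lambda>xs. j \<in> rtr_A xs)
    \<le> 2 * hit t (\<lfloor>a\<rfloor> + 1) + 8 * sqrt (2 * real t + 1) / real n"
proof -
  define C where "C = ({1..n} - {j}) \<times> {1..n}"
  \<comment> \<open>The least integer strictly above \<open>a\<close>, matching the strict
    inequality in the exit event.\<close>
  define K where "K = \<lfloor>a\<rfloor> + 1"
  have exit_iff: "a < \<bar>real y - real j\<bar> \<longleftrightarrow> \<bar>int y - int j\<bar> \<ge> K" for y
  proof -
    have "\<bar>real y - real j\<bar> = real_of_int \<bar>int y - int j\<bar>" by simp
    then show ?thesis unfolding K_def using a by linarith
  qed
  have C: "finite C" "card C = (n - 1) * n"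
    using j by (auto simp: C_def card_cartesian_product)
  then have cardC: "real (card C) = real n * (real n - 1)"
    using n by (simp add: of_nat_diff)
  let ?P = "\<lambda>\<sigma>. a < \<bar>real (\<sigma> j) - real j\<bar>"
  have B: "{xs \<in> rtr_paths n t. j \<in> rtr_A xs} = {xs. set xs \<subseteq> C \<and> length xs = t}"
    by (force simp: rtr_paths_def rtr_A_def C_def)
  have E: "{xs \<in> rtr_paths n t. (\<exists>m\<le>t. \<bar>real (rtr_walk (take m xs) j) - real j\<bar> > a) \<and> j \<in> rtr_A xs}
     = {xs. length xs = t \<and> set xs \<subseteq> C \<and> (\<exists>m\<le>t. ?P (foldl rtr_step id (take m xs)))}"
    using B by (auto simp: rtr_paths_def rtr_walk_def)
  have "real (card {xs. length xs = t \<and> set xs \<subseteq> C \<and> (\<exists>m\<le>t. ?P (foldl rtr_step id (take m xs)))})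
     \<le> real (card C) ^ t * barrier n K j t (id j)"
  proof (rule exit_count_le[where I = "\<lambda>\<sigma>. bij_betw \<sigma> {1..n} {1..n}"
        and V = "\<lambda>s \<sigma>. barrier n K j s (\<sigma> j)" and P = ?P])
    show "bij_betw (rtr_step \<sigma> c) {1..n} {1..n}" if "bij_betw \<sigma> {1..n} {1..n}" "c \<in> C" for \<sigma> c
      using that bij_betw_rtr_step by (cases c) (auto simp: C_def)
    show "(\<Sum>c\<in>C. barrier n K j s (rtr_step \<sigma> c j)) \<le> real (card C) * barrier n K j (Suc s) (\<sigma> j)"
      if "bij_betw \<sigma> {1..n} {1..n}" "\<not> ?P \<sigma>" for s \<sigma>
      unfolding cardC unfolding C_def
      using that exit_iff[of "\<sigma> j"] by (intro barrier_supersolution n j) auto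
  qed (use C exit_iff barrier_nonneg barrier_ge_1 in auto)
  moreover have "0 < real (card C) ^ t"
    using n cardC by simp
  moreover have "barrier n K j t (id j) = 2 * hit t K + 8 * sqrt (2 * real t + 1) / real n"
    by (simp add: barrier_def)
  ultimately show ?thesis
    unfolding rtr_cond_prob_def E B card_lists_length_eq[OF C(1)] K_def[symmetric]
    by (simp add: divide_le_eq mult.commute)
qed

section \<open>Central limit theorem for the fair binomial\<close>

text \<open>\<open>2 * l - N\<close> is a sum of \<open>N\<close> independent fair signs, with
  variance \<open>N\<close>.\<close>

definition standardized_binomial :: "nat \<Rightarrow> real pmf" where
  "standardized_binomial N = map_pmf (\<lambda>l. (2 * real l - real N) / sqrt (real N)) (binomial_pmf N (1/2))"

text \<open>A fair sign has characteristic function \<open>cos\<close>; the binomial theorem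
  supplies the product over the \<open>N\<close> signs.\<close>

lemma char_standardized_binomial:
  "char (distr (standardized_binomial N) borel id) x = complex_of_real (cos (x / sqrt (real N)) ^ N)"
proof -
  define y where "y = x / sqrt (real N)"
  have "char (distr (standardized_binomial N) borel id) x
      = measure_pmf.expectation (binomial_pmf N (1/2)) (\<lambda>l. iexp (y * (2 * real l - real N)))"
    unfolding char_def standardized_binomial_def
    by (subst integral_distr) (simp_all add: y_def)
  also have "\<dots> = (\<Sum>l\<le>N. (real (N choose l) * (1 / 2) ^ l * (1 - 1 / 2) ^ (N - l)) *\<^sub>R iexp (y * (2 * real l - real N)))"
    by (rule expectation_binomial_pmf') simp
  also have "\<dots> = (\<Sum>l\<le>N. of_nat (N choose l) * (cis y / 2) ^ l * (cis (- y) / 2) ^ (N - l))"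
  proof (rule sum.cong)
    fix l assume "l \<in> {..N}"
    then have "real l * y + real (N - l) * (- y) = y * (2 * real l - real N)"
      by (simp add: of_nat_diff algebra_simps)
    then have "cis y ^ l * cis (- y) ^ (N - l) = iexp (y * (2 * real l - real N))"
      by (simp only: Complex.DeMoivre cis_mult cis_conv_exp[symmetric])
    then show "(real (N choose l) * (1 / 2) ^ l * (1 - 1 / 2) ^ (N - l)) *\<^sub>R iexp (y * (2 * real l - real N))
        = of_nat (N choose l) * (cis y / 2) ^ l * (cis (- y) / 2) ^ (N - l)"
      by (simp add: scaleR_conv_of_real power_divide)
  qed simp
  also have "\<dots> = (cis y / 2 + cis (- y) / 2) ^ N"
    by (simp add: binomial_ring)
  also have "cis y / 2 + cis (- y) / 2 = complex_of_real (cos y)"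
    by (simp add: complex_eq_iff)
  finally show ?thesis unfolding y_def of_real_power .
qed

lemma cos_power_tendsto: "(\<lambda>N. cos (x / sqrt (real N)) ^ N) \<longlonglongrightarrow> exp (- x\<^sup>2 / 2)"
proof -
  have "((\<lambda>N::real. cos (x / sqrt N) powr N) \<longlongrightarrow> exp (- x\<^sup>2 / 2)) at_top"
    by (real_asymp simp: power2_eq_square)
  then have "(\<lambda>N. cos (x / sqrt (real N)) powr real N) \<longlonglongrightarrow> exp (- x\<^sup>2 / 2)"
    by (rule filterlim_compose) (rule filterlim_real_sequentially)
  \<comment> \<open>\<open>powr\<close> agrees with the natural power only once the cosine is
    positive.\<close>
  moreover have "\<forall>\<^sub>F N in sequentially. cos (x / sqrt (real N)) powr real N = cos (x / sqrt (real N)) ^ N"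
  proof -
    have "(\<lambda>N. cos (x / sqrt (real N))) \<longlonglongrightarrow> 1" by real_asymp
    then have "\<forall>\<^sub>F N in sequentially. cos (x / sqrt (real N)) > 0"
      by (rule order_tendstoD) simp
    then show ?thesis by eventually_elim (simp add: powr_realpow)
  qed
  ultimately show ?thesis by (rule Lim_transform_eventually)
qed

text \<open>Levy's continuity theorem. The normal law has no atoms, so its cdf is continuous at
  \<open>\<alpha>\<close>, and the open tail has the same limit as the closed tail in
  \<open>Psi\<close>.\<close>

lemma standardized_binomial_tail_tendsto:
  "(\<lambda>N. measure_pmf.prob (standardized_binomial N) {\<alpha><..}) \<longlonglongrightarrow> Psi \<alpha>"
proof -
  let ?M = "\<lambda>N. distr (measure_pmf (standardized_binomial N)) borel id"
  have M: "real_distribution (?M N)" for N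
    by (rule prob_space.real_distribution_distr) (auto intro: measure_pmf.prob_space_axioms)
  interpret Z: real_distribution std_normal_distribution by (rule real_dist_normal_dist)
  have "weak_conv_m ?M std_normal_distribution"
  proof (rule levy_continuity[OF M real_dist_normal_dist])
    show "(\<lambda>N. char (?M N) x) \<longlonglongrightarrow> char std_normal_distribution x" for x
      unfolding char_standardized_binomial char_std_normal_distribution
      by (rule tendsto_of_real, rule cos_power_tendsto)
  qed
  have null: "measure std_normal_distribution {\<alpha>} = 0"
  proof -
    have "emeasure std_normal_distribution {\<alpha>} = 0"
      by (subst emeasure_density) (auto intro!: nn_integral_null_set)
    then show ?thesis by (simp add: measure_def)
  qed
  with \<open>weak_conv_m ?M std_normal_distribution\<close>
  have cdf: "(\<lambda>N. cdf (?M N) \<alpha>) \<longlonglongrightarrow> cdf std_normal_distribution \<alpha>"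
    by (auto simp: weak_conv_m_def weak_conv_def Z.isCont_cdf)
  have "measure_pmf.prob (standardized_binomial N) {\<alpha><..} = 1 - cdf (?M N) \<alpha>" for N
  proof -
    have "- {..\<alpha>} = {\<alpha><..}" by auto
    then show ?thesis
      using measure_pmf.prob_compl[of "{..\<alpha>}" "standardized_binomial N"]
      by (simp add: cdf_def measure_distr Compl_eq_Diff_UNIV)
  qed
  moreover have "Psi \<alpha> = 1 - cdf std_normal_distribution \<alpha>"
  proof -
    have "measure std_normal_distribution {\<alpha>..} = measure std_normal_distribution ({\<alpha>} \<union> {\<alpha><..})"
      by (rule arg_cong[where f = "measure _"]) auto
    also have "\<dots> = measure std_normal_distribution {\<alpha><..}"
      by (subst Z.finite_measure_Union) (auto simp: null)
    also have "\<dots> = measure std_normal_distribution (UNIV - {..\<alpha>})"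
      by (rule arg_cong[where f = "measure _"]) auto
    also have "\<dots> = 1 - cdf std_normal_distribution \<alpha>"
      using Z.prob_compl[of "{..\<alpha>}"] by (simp add: cdf_def)
    finally show ?thesis by (simp add: Psi_def)
  qed
  ultimately show ?thesis
    using tendsto_diff[OF tendsto_const[of 1] cdf] by simp
qed

section \<open>Passage to the limit\<close>

text \<open>\<open>l \<ge> s + 1 + k\<close> gives
  \<open>2 * l - (2 * s + 1) \<ge> 2 * k + 1 > 2 * a + 1\<close>, so the standardized value lies
  strictly above \<open>\<alpha>\<close>.\<close>

lemma hit_le_binomial_tail:
  assumes c: "\<alpha> * sqrt (2 * real s + 1) \<le> 2 * a + 1" and a: "a < real_of_int k"
  shows "hit s k \<le> 2 * measure_pmf.prob (standardized_binomial (2 * s + 1)) {\<alpha><..}"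
proof -
  have "{l. int s + 1 + k \<le> int l}
      \<subseteq> (\<lambda>l. (2 * real l - real (2 * s + 1)) / sqrt (real (2 * s + 1))) -` {\<alpha><..}"
  proof
    fix l assume "l \<in> {l. int s + 1 + k \<le> int l}"
    then have "real_of_int (int s + 1 + k) \<le> real_of_int (int l)"
      by (simp only: of_int_le_iff mem_Collect_eq)
    then have "\<alpha> * sqrt (2 * real s + 1) < 2 * real l - real (2 * s + 1)"
      using c a by simp
    then show "l \<in> (\<lambda>l. (2 * real l - real (2 * s + 1)) / sqrt (real (2 * s + 1))) -` {\<alpha><..}"
      by (simp add: less_divide_eq add.commute)
  qed
  then have "measure_pmf.prob (binomial_pmf (2 * s + 1) (1/2)) {l. int s + 1 + k \<le> int l}
      \<le> measure_pmf.prob (standardized_binomial (2 * s + 1)) {\<alpha><..}"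
    unfolding standardized_binomial_def measure_map_pmf
    by (intro measure_pmf.finite_measure_mono) auto
  then show ?thesis by (simp add: hit_def btail_def)
qed

text \<open>The right side is \<open>\<alpha> * sqrt (2 * s) + 1\<close>, and
  \<open>sqrt (2 * s + 1) - sqrt (2 * s)\<close> tends to 0.\<close>

lemma eventually_threshold_le:
  fixes \<alpha> :: real
  shows "\<forall>\<^sub>F s in at_top. \<alpha> * sqrt (2 * s + 1) \<le> 2 * (\<alpha> * sqrt (s / 2)) + 1"
proof -
  have two: "2 * (\<alpha> * sqrt (s / 2)) = \<alpha> * sqrt (2 * s)" for s
  proof -
    have "sqrt (2 * s) = sqrt (4 * (s / 2))" by simp
    also have "\<dots> = 2 * sqrt (s / 2)" by (simp only: real_sqrt_mult real_sqrt_four)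
    finally show ?thesis by simp
  qed
  have "((\<lambda>s::real. sqrt (2 * s + 1) - sqrt (2 * s)) \<longlongrightarrow> 0) at_top"
    by real_asymp
  then have "((\<lambda>s. \<alpha> * (sqrt (2 * s + 1) - sqrt (2 * s))) \<longlongrightarrow> 0) at_top"
    by (rule tendsto_mult_right_zero)
  then have "\<forall>\<^sub>F s in at_top. \<alpha> * (sqrt (2 * s + 1) - sqrt (2 * s)) < 1"
    by (rule order_tendstoD) simp
  then show ?thesis
    unfolding two by eventually_elim (simp add: right_diff_distrib)
qed

theorem theorem3:
  fixes \<alpha> :: real and t :: "nat \<Rightarrow> nat"
  assumes "\<alpha> > 0"
    and "filterlim t at_top sequentially"
    and "filterlim (\<lambda>n. real n ^ 2 / real (t n)) at_top sequentially"
  shows "limsup (\<lambda>n. ereal (Max ((\<lambda>j. rtr_cond_prob n (t n)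
            (\<lambda>xs. \<exists>m \<le> t n. \<bar>real (rtr_walk (take m xs) j) - real j\<bar> > \<alpha> * sqrt (real (t n) / 2))
            (\<lambda>xs. j \<in> rtr_A xs)) ` {1..n})))
         \<le> ereal (4 * Psi \<alpha>)"
proof -
  let ?P = "\<lambda>n j. rtr_cond_prob n (t n)
            (\<lambda>xs. \<exists>m \<le> t n. \<bar>real (rtr_walk (take m xs) j) - real j\<bar> > \<alpha> * sqrt (real (t n) / 2))
            (\<lambda>xs. j \<in> rtr_A xs)"
  \<comment> \<open>A bound uniform in \<open>j\<close>: 4 is 2 for the two exit levels times 2 from
    \<open>hit\<close>, and the last term is the total drift cost.\<close>
  define B where "B n = 4 * measure_pmf.prob (standardized_binomial (2 * t n + 1)) {\<alpha><..}
    + 8 * sqrt (2 * real (t n) + 1) / real n" for n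
  have t_real: "filterlim (\<lambda>n. real (t n)) at_top sequentially"
    by (rule filterlim_compose[OF filterlim_real_sequentially assms(2)])
  have ev: "\<forall>\<^sub>F n in sequentially. \<alpha> * sqrt (2 * real (t n) + 1) \<le> 2 * (\<alpha> * sqrt (real (t n) / 2)) + 1"
    by (rule eventually_compose_filterlim[OF eventually_threshold_le t_real])
  have le_B: "\<forall>\<^sub>F n in sequentially. ereal (Max (?P n ` {1..n})) \<le> ereal (B n)"
    using ev eventually_ge_at_top[of 2]
  proof eventually_elim
    case (elim n)
    have "?P n j \<le> B n" if "j \<in> {1..n}" for j
    proof -
      let ?a = "\<alpha> * sqrt (real (t n) / 2)"
      have "?P n j \<le> 2 * hit (t n) (\<lfloor>?a\<rfloor> + 1) + 8 * sqrt (2 * real (t n) + 1) / real n"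
        using elim(2) that assms(1) by (intro rtr_cond_prob_exit_le) auto
      also have "hit (t n) (\<lfloor>?a\<rfloor> + 1) \<le> 2 * measure_pmf.prob (standardized_binomial (2 * t n + 1)) {\<alpha><..}"
        by (rule hit_le_binomial_tail[OF elim(1)]) linarith
      finally show ?thesis by (simp add: B_def)
    qed
    moreover have "{1..n} \<noteq> {}" using elim(2) by auto
    ultimately show ?case by simp
  qed
  have "B \<longlonglongrightarrow> 4 * Psi \<alpha> + 0"
    unfolding B_def
  proof (intro tendsto_add tendsto_mult tendsto_const)
    have "filterlim (\<lambda>n. 2 * t n + 1) at_top sequentially"
      by (rule filterlim_at_top_mono[OF assms(2)]) simp
    then show "(\<lambda>n. measure_pmf.prob (standardized_binomial (2 * t n + 1)) {\<alpha><..}) \<longlonglongrightarrow> Psi \<alpha>"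
      by (rule filterlim_compose[OF standardized_binomial_tail_tendsto])
    have "(\<lambda>n. inverse (real n ^ 2 / real (t n))) \<longlonglongrightarrow> 0"
      by (rule tendsto_inverse_0_at_top[OF assms(3)])
    then have "(\<lambda>n. 8 * sqrt (3 * inverse (real n ^ 2 / real (t n)))) \<longlonglongrightarrow> 8 * sqrt (3 * 0)"
      by (intro tendsto_mult tendsto_real_sqrt tendsto_const)
    then have upper: "(\<lambda>n. 8 * sqrt (3 * inverse (real n ^ 2 / real (t n)))) \<longlonglongrightarrow> 0"
      by simp
    \<comment> \<open>Once \<open>t n \<ge> 1\<close>, \<open>2 * t n + 1 \<le> 3 * t n\<close>,
      which leaves a multiple of the square root of \<open>t n / n ^ 2\<close>.\<close>
    have le: "\<forall>\<^sub>F n in sequentially. 8 * sqrt (2 * real (t n) + 1) / real n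
        \<le> 8 * sqrt (3 * inverse (real n ^ 2 / real (t n)))"
      using filterlim_at_top[THEN iffD1, OF assms(2), rule_format, of 1]
    proof eventually_elim
      case (elim n)
      have "8 * sqrt (2 * real (t n) + 1) / real n \<le> 8 * sqrt (3 * real (t n)) / real n"
        using elim by (intro divide_right_mono mult_left_mono real_sqrt_le_mono) auto
      also have "\<dots> = 8 * sqrt (3 * inverse (real n ^ 2 / real (t n)))"
      proof -
        have "3 * inverse (real n ^ 2 / real (t n)) = 3 * real (t n) / real n ^ 2" by simp
        then show ?thesis by (simp only: real_sqrt_divide real_sqrt_abs abs_of_nat)
      qed
      finally show ?case .
    qed
    have ge: "\<forall>\<^sub>F n in sequentially. 0 \<le> 8 * sqrt (2 * real (t n) + 1) / real n"
      by simp
    show "(\<lambda>n. 8 * sqrt (2 * real (t n) + 1) / real n) \<longlonglongrightarrow> 0"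
      by (rule tendsto_sandwich[OF ge le tendsto_const upper])
  qed
  then have "limsup (\<lambda>n. ereal (B n)) = ereal (4 * Psi \<alpha>)"
    by (intro lim_imp_Limsup) auto
  with Limsup_mono[OF le_B] show ?thesis by simp
qed

end
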